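(* Every locally weakly linearly convex domain $D\subset\mathbb C^n$ is pseudoconvex. Moreover, if such a domain $D$ is bounded, then $D$ is taut.
   Context: A domain is a connected open set. A domain $D\subset\mathbb C^n$ is called locally weakly linearly convex if for every boundary point $a\in\partial D$ there are a complex (affine) hyperplane $H_a$ through $a$ and a neighborhood $U_a$ of $a$ such that $H_a\cap D\cap U_a=\varnothing$. Let $\mathbb D\subset\mathbb C$ be the open unit disc. A domain $D\subset\mathbb C^n$ is called taut if the family $\mathcal O(\mathbb D,D)$ of holomorphic maps $\mathbb D\to D$ is normal, i.e. every sequence in $\mathcal O(\mathbb D,D)$ has a subsequence that either converges locally uniformly on $\mathbb D$ to a map in $\mathcal O(\mathbb D,D)$ or diverges compactly (for all compact $K\subset\mathbb D$, $L\subset D$, the maps of the subsequence eventually satisfy $\varphi_j(K)\cap L=\varnothing$). *)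

theory Defs
  imports "HOL-Complex_Analysis.Complex_Analysis"
begin

definition complex_domain :: "(complex ^ 'n) set \<Rightarrow> bool" where
  "complex_domain D \<longleftrightarrow> open D \<and> connected D"

definition complex_hyperplane :: "(complex ^ 'n) set \<Rightarrow> bool" where
  "complex_hyperplane H \<longleftrightarrow>
     (\<exists>c b. c \<noteq> 0 \<and> H = {z. (\<Sum>i\<in>UNIV. c $ i * z $ i) = b})"

definition locally_weakly_linearly_convex :: "(complex ^ 'n) set \<Rightarrow> bool" where
  "locally_weakly_linearly_convex D \<longleftrightarrow>
     (\<forall>a\<in>frontier D. \<exists>H U. complex_hyperplane H \<and> a \<in> H \<and> open U \<and> a \<in> U \<and> H \<inter> D \<inter> U = {})"

text \<open>
  (Pluri)subharmonicity is only needed for continuous real-valued functions, so that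
  the circle means below are integrals of continuous functions.
\<close>

definition continuous_subharmonic_on :: "complex set \<Rightarrow> (complex \<Rightarrow> real) \<Rightarrow> bool" where
  "continuous_subharmonic_on G u \<longleftrightarrow> continuous_on G u \<and>
     (\<forall>\<zeta> r. 0 < r \<and> cball \<zeta> r \<subseteq> G \<longrightarrow>
        u \<zeta> \<le> integral {0..2 * pi} (\<lambda>t. u (\<zeta> + of_real r * cis t)) / (2 * pi))"

definition continuous_plurisubharmonic_on ::
    "(complex ^ 'n) set \<Rightarrow> (complex ^ 'n \<Rightarrow> real) \<Rightarrow> bool" where
  "continuous_plurisubharmonic_on D u \<longleftrightarrow> continuous_on D u \<and>
     (\<forall>a w. continuous_subharmonic_on {\<zeta>. a + \<zeta> *s w \<in> D} (\<lambda>\<zeta>. u (a + \<zeta> *s w)))"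

text \<open>
  Pseudoconvexity is the existence of a continuous plurisubharmonic exhaustion function.
  Taking it real-valued is no restriction: a function \<open>u\<close> with values in \<open>[-\<infinity>, \<infinity>)\<close>
  can be replaced by \<open>max u 0\<close>.
\<close>

definition pseudoconvex :: "(complex ^ 'n) set \<Rightarrow> bool" where
  "pseudoconvex D \<longleftrightarrow>
     (\<exists>u. continuous_plurisubharmonic_on D u \<and>
        (\<forall>c. compact (closure {z \<in> D. u z < c}) \<and> closure {z \<in> D. u z < c} \<subseteq> D))"

text \<open>
  The library predicate for holomorphy covers only scalar-valued functions, so maps into
  \<open>complex ^ 'n\<close> are required to be holomorphic in each component.
\<close>

definition holomorphic_discs :: "(complex ^ 'n) set \<Rightarrow> (complex \<Rightarrow> complex ^ 'n) set" where
  "holomorphic_discs D =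
     {f. (\<forall>i. (\<lambda>\<zeta>. f \<zeta> $ i) holomorphic_on ball 0 1) \<and> f ` ball 0 1 \<subseteq> D}"

definition locally_uniform_limit_on_disc ::
    "(nat \<Rightarrow> complex \<Rightarrow> complex ^ 'n) \<Rightarrow> (complex \<Rightarrow> complex ^ 'n) \<Rightarrow> bool" where
  "locally_uniform_limit_on_disc \<phi> g \<longleftrightarrow>
     (\<forall>\<zeta>\<in>ball 0 1. \<exists>V. open V \<and> \<zeta> \<in> V \<and> V \<subseteq> ball 0 1 \<and> uniform_limit V \<phi> g sequentially)"

definition compactly_divergent ::
    "(complex ^ 'n) set \<Rightarrow> (nat \<Rightarrow> complex \<Rightarrow> complex ^ 'n) \<Rightarrow> bool" where
  "compactly_divergent D \<phi> \<longleftrightarrow>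
     (\<forall>K L. compact K \<and> K \<subseteq> ball 0 1 \<and> compact L \<and> L \<subseteq> D \<longrightarrow>
        (\<forall>\<^sub>F j in sequentially. \<phi> j ` K \<inter> L = {}))"

definition taut :: "(complex ^ 'n) set \<Rightarrow> bool" where
  "taut D \<longleftrightarrow>
     (\<forall>\<phi>. (\<forall>j. \<phi> j \<in> holomorphic_discs D) \<longrightarrow>
        (\<exists>s :: nat \<Rightarrow> nat. strict_mono s \<and>
           ((\<exists>g\<in>holomorphic_discs D. locally_uniform_limit_on_disc (\<phi> \<circ> s) g) \<or>
            compactly_divergent D (\<phi> \<circ> s))))"

end

theory Submission
  imports Defs
begin

text \<open>
  Both assertions rest on one dichotomy for limits of holomorphic maps into \<open>D\<close>
  (lemma \<open>limit_of_discs_inside_or_outside\<close>): if maps \<open>f n\<close> from a connected open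
  set into \<open>D\<close> converge locally uniformly to \<open>g\<close>, then \<open>g\<close> either stays in \<open>D\<close> or
  never meets \<open>D\<close>. Indeed, if \<open>g\<close> meets the boundary at \<open>a\<close>, let \<open>l\<close> be the affine form
  whose zero set is the hyperplane at \<open>a\<close>. Near the point in question the functions
  \<open>l \<circ> f n\<close> have no zeros while their limit \<open>l \<circ> g\<close> has one, so \<open>l \<circ> g\<close> vanishes
  identically there by Hurwitz' theorem, and \<open>g\<close> remains in the hyperplane, hence
  outside \<open>D\<close>. The set of points that \<open>g\<close> sends outside \<open>D\<close> is therefore open as
  well as closed.

  Tautness of a bounded \<open>D\<close> is immediate: by Montel's theorem a subsequence converges
  locally uniformly. If the limit stays in \<open>D\<close> it is the desired map, and if it never
  meets \<open>D\<close> the subsequence diverges compactly.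

  For pseudoconvexity the dichotomy gives the continuity principle
  (\<open>continuity_principle\<close>): a continuous family of closed discs whose rims lie in
  \<open>D\<close>, and whose first member lies in \<open>D\<close>, consists of discs in \<open>D\<close>. From this,
  minus the logarithm of the distance to the complement is plurisubharmonic. If on the
  rim of a closed disc \<open>a + \<zeta> w\<close> in \<open>D\<close> it is smaller than \<open>Re F\<close> with \<open>F\<close> entire, then the
  discs \<open>a + \<zeta> w + t exp (- F \<zeta>) V\<close> with \<open>norm V < 1\<close> and \<open>0 \<le> t \<le> 1\<close> have their
  rims in \<open>D\<close>, so they lie in \<open>D\<close>. At the centre this says that the distance to the
  complement is at least \<open>exp (- Re F)\<close>. Real parts of polynomials are dense in the
  continuous functions on a circle, so these comparisons imply the sub-mean-value inequality.
  The maximum of this function with the norm is the exhaustion function.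
\<close>

text \<open>The symbol \<open>$\<close> is reserved for components of vectors.\<close>

no_notation fps_nth (infixl "$" 75)

section \<open>Limits of holomorphic maps\<close>

lemma holomorphic_linear_form:
  fixes f :: "complex \<Rightarrow> complex ^ 'n"
  assumes "\<And>i. (\<lambda>\<zeta>. f \<zeta> $ i) holomorphic_on S"
  shows "(\<lambda>\<zeta>. (\<Sum>i\<in>UNIV. c $ i * f \<zeta> $ i) - b) holomorphic_on S"
  using assms by (intro holomorphic_intros)

lemma continuous_on_holomorphic_components:
  fixes f :: "complex \<Rightarrow> complex ^ 'n"
  assumes "\<And>i. (\<lambda>\<zeta>. f \<zeta> $ i) holomorphic_on S"
  shows "continuous_on S f"
proof -
  have "continuous_on S (\<lambda>\<zeta>. \<chi> i. f \<zeta> $ i)"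
    by (intro continuous_intros holomorphic_on_imp_continuous_on assms)
  then show ?thesis by simp
qed

lemma linear_form_bound:
  fixes c x y :: "complex ^ 'n"
  shows "cmod ((\<Sum>i\<in>UNIV. c $ i * x $ i) - (\<Sum>i\<in>UNIV. c $ i * y $ i))
           \<le> (\<Sum>i\<in>UNIV. cmod (c $ i)) * dist x y"
proof -
  have "(\<Sum>i\<in>UNIV. c $ i * x $ i) - (\<Sum>i\<in>UNIV. c $ i * y $ i) = (\<Sum>i\<in>UNIV. c $ i * (x - y) $ i)"
    by (simp add: sum_subtractf right_diff_distrib)
  also have "cmod \<dots> \<le> (\<Sum>i\<in>UNIV. cmod (c $ i) * dist x y)"
    by (rule sum_norm_le)
       (auto simp only: norm_mult dist_norm intro!: mult_left_mono Finite_Cartesian_Product.norm_nth_le norm_ge_zero)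
  finally show ?thesis by (simp add: sum_distrib_right)
qed

lemma uniform_limit_linear_form:
  fixes f :: "nat \<Rightarrow> complex \<Rightarrow> complex ^ 'n"
  assumes "uniform_limit K f g sequentially"
  shows "uniform_limit K (\<lambda>n \<zeta>. (\<Sum>i\<in>UNIV. c $ i * f n \<zeta> $ i) - b)
           (\<lambda>\<zeta>. (\<Sum>i\<in>UNIV. c $ i * g \<zeta> $ i) - b) sequentially"
proof (rule uniform_limitI)
  fix e :: real assume "e > 0"
  define M where "M = (\<Sum>i\<in>UNIV. cmod (c $ i)) + 1"
  have M: "M > 0" by (simp add: M_def add_nonneg_pos sum_nonneg)
  have "\<forall>\<^sub>F n in sequentially. \<forall>x\<in>K. dist (f n x) (g x) < e / M"
    using assms \<open>e > 0\<close> M by (intro uniform_limitD) auto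
  then show "\<forall>\<^sub>F n in sequentially. \<forall>x\<in>K. dist ((\<Sum>i\<in>UNIV. c $ i * f n x $ i) - b)
               ((\<Sum>i\<in>UNIV. c $ i * g x $ i) - b) < e"
  proof (eventually_elim, intro ballI)
    fix n x assume *: "\<forall>x\<in>K. dist (f n x) (g x) < e / M" and "x \<in> K"
    have "dist ((\<Sum>i\<in>UNIV. c $ i * f n x $ i) - b) ((\<Sum>i\<in>UNIV. c $ i * g x $ i) - b)
        \<le> (\<Sum>i\<in>UNIV. cmod (c $ i)) * dist (f n x) (g x)"
      using linear_form_bound[of c "f n x" "g x"] by (simp add: dist_norm)
    also have "\<dots> \<le> M * dist (f n x) (g x)"
      by (rule mult_right_mono) (auto simp: M_def)
    also have "\<dots> < e"
      using * \<open>x \<in> K\<close> M by (simp add: pos_less_divide_eq mult.commute)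
    finally show "dist ((\<Sum>i\<in>UNIV. c $ i * f n x $ i) - b) ((\<Sum>i\<in>UNIV. c $ i * g x $ i) - b) < e" .
  qed
qed

text \<open>
  The set of points that \<open>g\<close> maps outside \<open>D\<close> is open: by Hurwitz' theorem, once the limit touches
  a local supporting hyperplane it stays in it. Since that set is also closed in the connected
  set \<open>S\<close>, it is empty or everything.
\<close>

lemma limit_of_discs_inside_or_outside:
  fixes D :: "(complex ^ 'n) set" and f :: "nat \<Rightarrow> complex \<Rightarrow> complex ^ 'n"
    and g :: "complex \<Rightarrow> complex ^ 'n"
  assumes D: "open D" "locally_weakly_linearly_convex D"
    and S: "open S" "connected S"
    and holf: "\<And>n i. (\<lambda>\<zeta>. f n \<zeta> $ i) holomorphic_on S"
    and holg: "\<And>i. (\<lambda>\<zeta>. g \<zeta> $ i) holomorphic_on S"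
    and fD: "\<And>n \<zeta>. \<zeta> \<in> S \<Longrightarrow> f n \<zeta> \<in> D"
    and lim: "\<And>K. compact K \<Longrightarrow> K \<subseteq> S \<Longrightarrow> uniform_limit K f g sequentially"
  shows "g ` S \<subseteq> D \<or> g ` S \<inter> D = {}"
proof -
  have contg: "continuous_on S g"
    by (rule continuous_on_holomorphic_components) (rule holg)
  have opn: "open {\<zeta> \<in> S. g \<zeta> \<in> D}"
    using continuous_open_preimage[OF contg S(1) D(1)] by (simp add: vimage_def Int_def)
  have opn': "open {\<zeta> \<in> S. g \<zeta> \<notin> D}"
    unfolding open_contains_ball
  proof
    fix z0 assume z0: "z0 \<in> {\<zeta> \<in> S. g \<zeta> \<notin> D}"
    have "(\<lambda>n. f n z0) \<longlonglongrightarrow> g z0"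
      using lim[of "{z0}"] z0 by (intro tendsto_uniform_limitI[where S = "{z0}"]) auto
    then have "g z0 \<in> closure D"
      using fD z0 unfolding closure_sequential by (intro exI[of _ "\<lambda>n. f n z0"]) auto
    with z0 D(1) have "g z0 \<in> frontier D"
      by (simp add: frontier_def interior_open)
    with D(2) obtain H U where H: "complex_hyperplane H" "g z0 \<in> H" "open U" "g z0 \<in> U"
        "H \<inter> D \<inter> U = {}"
      unfolding locally_weakly_linearly_convex_def by blast
    then obtain c b where Hcb: "H = {z. (\<Sum>i\<in>UNIV. c $ i * z $ i) = b}"
      unfolding complex_hyperplane_def by blast
    obtain e where e: "e > 0" "ball (g z0) e \<subseteq> U"
      using H open_contains_ball by blast
    have "open {\<zeta> \<in> S. g \<zeta> \<in> ball (g z0) (e/2)}"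
      using continuous_open_preimage[OF contg S(1) open_ball, of "g z0" "e/2"]
      by (simp only: vimage_def Int_def mem_Collect_eq)
    moreover have "z0 \<in> {\<zeta> \<in> S. g \<zeta> \<in> ball (g z0) (e/2)}" using z0 e(1) by simp
    ultimately obtain r where r: "r > 0" "cball z0 r \<subseteq> {\<zeta> \<in> S. g \<zeta> \<in> ball (g z0) (e/2)}"
      using open_contains_cball by blast
    have "\<forall>\<^sub>F n in sequentially. \<forall>x\<in>cball z0 r. dist (f n x) (g x) < e/2"
      using lim[of "cball z0 r"] r e(1) by (intro uniform_limitD) auto
    then obtain N where N: "\<And>n x. n \<ge> N \<Longrightarrow> x \<in> cball z0 r \<Longrightarrow> dist (f n x) (g x) < e/2"
      unfolding eventually_sequentially by blast
    have fU: "f n x \<in> U" if "n \<ge> N" "x \<in> cball z0 r" for n x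
    proof -
      have "dist (g z0) (g x) < e/2" using r(2) that(2) by auto
      with N[OF that] have "dist (g z0) (f n x) < e"
        by (metis dist_commute dist_triangle_half_r)
      with e(2) show ?thesis by auto
    qed
    \<comment> \<open>The shift by \<open>N\<close> keeps all the maps inside \<open>U\<close> near \<open>z0\<close>, so every \<open>hn n\<close> is free of zeros.\<close>
    define h where "h = (\<lambda>\<zeta>. (\<Sum>i\<in>UNIV. c $ i * g \<zeta> $ i) - b)"
    define hn where "hn = (\<lambda>n \<zeta>. (\<Sum>i\<in>UNIV. c $ i * f (n + N) \<zeta> $ i) - b)"
    have bS: "ball z0 r \<subseteq> S" using r(2) ball_subset_cball[of z0 r] by blast
    have h0: "h z0 = 0" using H(2) Hcb by (simp add: h_def)
    have "h constant_on ball z0 r"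
    proof (rule ccontr)
      assume nc: "\<not> h constant_on ball z0 r"
      have "h z0 \<noteq> 0"
      proof (rule Hurwitz_no_zeros[of "ball z0 r" hn h z0])
        show "hn n holomorphic_on ball z0 r" for n
          unfolding hn_def using holf bS
          by (intro holomorphic_linear_form) (blast intro: holomorphic_on_subset)
        show "h holomorphic_on ball z0 r"
          unfolding h_def using holg bS
          by (intro holomorphic_linear_form) (blast intro: holomorphic_on_subset)
        show "uniform_limit K hn h sequentially" if "compact K" "K \<subseteq> ball z0 r" for K
        proof -
          have "uniform_limit K f g sequentially" using that bS by (intro lim) auto
          then have "uniform_limit K (\<lambda>n. f (n + N)) g sequentially"
            by (rule filterlim_compose[OF _ filterlim_add_const_nat_at_top])
          then show ?thesis unfolding hn_def h_def by (rule uniform_limit_linear_form)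
        qed
        show "hn n z \<noteq> 0" if "z \<in> ball z0 r" for n z
        proof -
          have "f (n + N) z \<in> D" "f (n + N) z \<in> U" using that bS fD fU by auto
          with H(5) have "f (n + N) z \<notin> H" by blast
          then show ?thesis by (simp add: Hcb hn_def)
        qed
      qed (use r nc in auto)
      with h0 show False by simp
    qed
    then have h_eq: "h z = 0" if "z \<in> ball z0 r" for z
      using h0 that r(1) unfolding constant_on_def by (metis centre_in_ball)
    have "ball z0 r \<subseteq> {\<zeta> \<in> S. g \<zeta> \<notin> D}"
    proof
      fix z assume z: "z \<in> ball z0 r"
      then have "z \<in> cball z0 r" by simp
      then have "z \<in> S" "dist (g z0) (g z) < e/2" using r(2) by auto
      moreover have "g z \<in> H" using h_eq[OF z] by (simp add: h_def Hcb)
      ultimately show "z \<in> {\<zeta> \<in> S. g \<zeta> \<notin> D}" using H(5) e by fastforce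
    qed
    with r(1) show "\<exists>e>0. ball z0 e \<subseteq> {\<zeta> \<in> S. g \<zeta> \<notin> D}" by blast
  qed
  have "{\<zeta> \<in> S. g \<zeta> \<in> D} \<inter> S = {} \<or> {\<zeta> \<in> S. g \<zeta> \<notin> D} \<inter> S = {}"
    using S(2) opn opn' by (intro connectedD) auto
  then show ?thesis by blast
qed

section \<open>The continuity principle\<close>

text \<open>
  The parameters whose disc lies in \<open>D\<close> form an open set because the discs are compact,
  and a closed set because of the dichotomy: a limit disc whose interior misses \<open>D\<close> would have its rim
  outside the open set \<open>D\<close>, too.
\<close>

lemma continuity_principle:
  fixes D :: "(complex ^ 'n) set" and \<Psi> :: "real \<Rightarrow> complex \<Rightarrow> complex ^ 'n"
  assumes D: "open D" "locally_weakly_linearly_convex D"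
    and r: "r > 0"
    and cont: "continuous_on ({0..1} \<times> cball z0 r) (\<lambda>(t, \<zeta>). \<Psi> t \<zeta>)"
    and hol: "\<And>t i. t \<in> {0..1} \<Longrightarrow> (\<lambda>\<zeta>. \<Psi> t \<zeta> $ i) holomorphic_on ball z0 r"
    and start: "\<Psi> 0 ` cball z0 r \<subseteq> D"
    and rim: "\<And>t. t \<in> {0..1} \<Longrightarrow> \<Psi> t ` sphere z0 r \<subseteq> D"
    and t: "t \<in> {0..1}"
  shows "\<Psi> t ` cball z0 r \<subseteq> D"
proof -
  define T where "T = {t \<in> {0..1}. \<Psi> t ` cball z0 r \<subseteq> D}"
  define E where "E = {t \<in> {0..1}. \<not> \<Psi> t ` cball z0 r \<subseteq> D}"
  let ?P = "{0..1} \<times> cball z0 r :: (real \<times> complex) set"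
  have cP: "compact ?P" by (intro compact_Times) auto
  \<comment> \<open>The projection of a compact set of bad pairs.\<close>
  have "closed E"
  proof -
    have "closedin (top_of_set ?P) (?P \<inter> (\<lambda>(t, \<zeta>). \<Psi> t \<zeta>) -` (- D))"
      using D(1) by (intro continuous_closedin_preimage[OF cont]) auto
    then have "compact (?P \<inter> (\<lambda>(t, \<zeta>). \<Psi> t \<zeta>) -` (- D))"
      using cP closedin_compact by blast
    then have "compact (fst ` (?P \<inter> (\<lambda>(t, \<zeta>). \<Psi> t \<zeta>) -` (- D)))"
      by (intro compact_continuous_image continuous_intros)
    moreover have "fst ` (?P \<inter> (\<lambda>(t, \<zeta>). \<Psi> t \<zeta>) -` (- D)) = E"
      unfolding E_def by force
    ultimately show ?thesis by (simp add: compact_imp_closed)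
  qed
  moreover have "closed T"
    unfolding closed_sequential_limits
  proof (intro allI impI)
    fix s l assume sl: "(\<forall>n. s n \<in> T) \<and> s \<longlonglongrightarrow> l"
    then have s01: "s n \<in> {0..1}" for n by (auto simp: T_def)
    have l01: "l \<in> {0..1}"
      using closed_sequentially[of "{0..1}" s l] sl s01 by auto
    have unif: "uniform_limit (cball z0 r) (\<lambda>n. \<Psi> (s n)) (\<Psi> l) sequentially"
    proof (rule uniform_limitI)
      fix e :: real assume "e > 0"
      have "uniformly_continuous_on ?P (\<lambda>(t, \<zeta>). \<Psi> t \<zeta>)"
        by (rule compact_uniformly_continuous[OF cont cP])
      then obtain d where d: "d > 0" "\<And>x y. x \<in> ?P \<Longrightarrow> y \<in> ?P \<Longrightarrow> dist y x < d \<Longrightarrow>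
           dist ((\<lambda>(t, \<zeta>). \<Psi> t \<zeta>) y) ((\<lambda>(t, \<zeta>). \<Psi> t \<zeta>) x) < e"
        unfolding uniformly_continuous_on_def using \<open>e > 0\<close> by metis
      have "\<forall>\<^sub>F n in sequentially. dist (s n) l < d"
        using sl d(1) by (simp add: tendsto_iff)
      then show "\<forall>\<^sub>F n in sequentially. \<forall>x\<in>cball z0 r. dist (\<Psi> (s n) x) (\<Psi> l x) < e"
      proof (eventually_elim, intro ballI)
        fix n x assume "dist (s n) l < d" "x \<in> cball z0 r"
        then show "dist (\<Psi> (s n) x) (\<Psi> l x) < e"
          using d(2)[of "(l, x)" "(s n, x)"] l01 s01[of n] by (simp add: dist_Pair_Pair)
      qed
    qed
    have alt: "\<Psi> l ` ball z0 r \<subseteq> D \<or> \<Psi> l ` ball z0 r \<inter> D = {}"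
    proof (rule limit_of_discs_inside_or_outside[OF D])
      show "(\<lambda>\<zeta>. \<Psi> (s n) \<zeta> $ i) holomorphic_on ball z0 r" for n i
        using hol s01 by blast
      show "(\<lambda>\<zeta>. \<Psi> l \<zeta> $ i) holomorphic_on ball z0 r" for i
        using hol l01 by blast
      show "\<Psi> (s n) \<zeta> \<in> D" if "\<zeta> \<in> ball z0 r" for n \<zeta>
        using sl that by (auto simp: T_def image_subset_iff)
      show "uniform_limit K (\<lambda>n. \<Psi> (s n)) (\<Psi> l) sequentially" if "K \<subseteq> ball z0 r" for K
        using unif that ball_subset_cball uniform_limit_on_subset by (metis subset_trans)
    qed auto
    have contl: "continuous_on (cball z0 r) (\<Psi> l)"
    proof -
      have "continuous_on (cball z0 r) ((\<lambda>(t, \<zeta>). \<Psi> t \<zeta>) \<circ> (\<lambda>\<zeta>. (l, \<zeta>)))"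
        using l01 by (intro continuous_on_compose continuous_intros continuous_on_subset[OF cont]) auto
      then show ?thesis by (simp add: o_def)
    qed
    have "\<Psi> l ` ball z0 r \<subseteq> D"
    proof (rule ccontr)
      assume "\<not> \<Psi> l ` ball z0 r \<subseteq> D"
      with alt have "\<Psi> l ` ball z0 r \<subseteq> - D" by blast
      then have "\<Psi> l ` closure (ball z0 r) \<subseteq> - D"
        using contl r D(1) by (intro image_closure_subset) auto
      then have "\<Psi> l ` cball z0 r \<subseteq> - D" using r by simp
      moreover have "z0 + of_real r \<in> sphere z0 r" using r by (simp add: dist_norm)
      moreover from this have "z0 + of_real r \<in> cball z0 r" by simp
      ultimately show False using rim[OF l01] by blast
    qed
    moreover have "cball z0 r = ball z0 r \<union> sphere z0 r" by auto
    ultimately show "l \<in> T"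
      using rim[OF l01] l01 by (auto simp: T_def image_Un)
  qed
  moreover have "T \<union> E = {0..1}" "T \<inter> E = {}" by (auto simp: T_def E_def)
  moreover have "0 \<in> T" using start by (simp add: T_def)
  ultimately have "T \<inter> {0..1} = {} \<or> E \<inter> {0..1} = {}" "0 \<in> T \<inter> {0..1}" "E \<subseteq> {0..1}"
    using connected_closedD[OF connected_Icc[of "0::real" 1], of T E] by auto
  then have "E = {}" by blast
  with t show ?thesis by (auto simp: E_def)
qed

section \<open>Subharmonicity by comparison with harmonic polynomials\<close>

lemma mean_value_entire:
  assumes "F holomorphic_on UNIV" "r > 0"
  shows "((\<lambda>t. F (z0 + of_real r * cis t)) has_integral (2 * of_real pi * F z0)) {0..2*pi}"
proof -
  have contF: "continuous_on A F" for A
    using assms(1) holomorphic_on_imp_continuous_on continuous_on_subset by blast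
  have "((\<lambda>u. F u/(u-z0)) has_contour_integral (2 * of_real pi * \<i> * F z0)) (circlepath z0 r)"
    using assms by (intro Cauchy_integral_circlepath contF) (auto intro: holomorphic_on_subset)
  then have "contour_integral (circlepath z0 r) (\<lambda>u. F u/(u-z0)) = 2 * of_real pi * \<i> * F z0"
    by (rule contour_integral_unique)
  then have "integral {0..2*pi} (\<lambda>t. F (z0 + of_real r * cis t) / (of_real r * cis t) * r * \<i> * cis t)
       = 2 * of_real pi * \<i> * F z0"
    unfolding circlepath_def by (subst (asm) contour_integral_part_circlepath_eq) auto
  moreover have "(\<lambda>t. F (z0 + of_real r * cis t) / (of_real r * cis t) * r * \<i> * cis t)
       = (\<lambda>t. \<i> * F (z0 + of_real r * cis t))"
    using assms(2) by (auto simp: fun_eq_iff field_simps)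
  ultimately have "integral {0..2*pi} (\<lambda>t. \<i> * F (z0 + of_real r * cis t)) = \<i> * (2 * of_real pi * F z0)"
    by (simp only: mult_ac)
  then have "integral {0..2*pi} (\<lambda>t. F (z0 + of_real r * cis t)) = 2 * of_real pi * F z0"
    by simp
  moreover have "(\<lambda>t. F (z0 + of_real r * cis t)) integrable_on {0..2*pi}"
    by (intro integrable_continuous_interval continuous_on_compose2[OF contF[of UNIV]]
          continuous_intros) auto
  ultimately show ?thesis by (simp add: has_integral_iff)
qed

text \<open>
  On the unit circle these functions are the real trigonometric polynomials. This
  description makes it possible to extend them to harmonic functions inside the circle, in
  contrast to the polynomials in \<open>Re z\<close> and \<open>Im z\<close> that the Stone-Weierstrass theorem supplies.
\<close>

definition Re_polynomial_on_circle :: "(complex \<Rightarrow> real) \<Rightarrow> bool" where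
  "Re_polynomial_on_circle p \<longleftrightarrow> (\<exists>P. \<forall>z. cmod z = 1 \<longrightarrow> p z = Re (poly P z))"

lemma Re_polynomial_on_circle_add:
  assumes "Re_polynomial_on_circle p" "Re_polynomial_on_circle q"
  shows "Re_polynomial_on_circle (\<lambda>z. p z + q z)"
proof -
  obtain P Q where "\<And>z. cmod z = 1 \<Longrightarrow> p z = Re (poly P z)" "\<And>z. cmod z = 1 \<Longrightarrow> q z = Re (poly Q z)"
    using assms unfolding Re_polynomial_on_circle_def by blast
  then show ?thesis unfolding Re_polynomial_on_circle_def by (intro exI[of _ "P + Q"]) auto
qed

lemma Re_polynomial_on_circle_sum:
  assumes "finite A" "\<And>a. a \<in> A \<Longrightarrow> Re_polynomial_on_circle (p a)"
  shows "Re_polynomial_on_circle (\<lambda>z. \<Sum>a\<in>A. p a z)"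
  using assms
proof (induction rule: finite_induct)
  case empty
  show ?case unfolding Re_polynomial_on_circle_def by (intro exI[of _ 0]) auto
next
  case (insert a A)
  then show ?case by (simp add: Re_polynomial_on_circle_add)
qed

text \<open>
  From \<open>Re x * Re y = Re (x * y + x * cnj y) / 2\<close> and \<open>cnj z = 1 / z\<close> on the unit circle;
  the order of the exponents keeps the power \<open>z ^ (j - k)\<close> a polynomial.
\<close>

lemma Re_monomials_mult:
  assumes "k \<le> j"
  shows "Re_polynomial_on_circle (\<lambda>z. Re (a * z ^ j) * Re (b * z ^ k))"
  unfolding Re_polynomial_on_circle_def
proof (intro exI[of _ "monom (a * b / 2) (j + k) + monom (a * cnj b / 2) (j - k)"] allI impI)
  fix z :: complex assume z: "cmod z = 1"
  have "z * cnj z = 1" using z by (simp add: complex_norm_square[symmetric])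
  then have "z ^ k * cnj (z ^ k) = 1" by (simp add: power_mult_distrib[symmetric])
  then have "z ^ (j - k) = z ^ (j - k) * (z ^ k * cnj (z ^ k))" by simp
  also have "\<dots> = z ^ j * cnj (z ^ k)"
    using assms by (simp add: power_add[symmetric] mult.assoc[symmetric])
  finally have "poly (monom (a * b / 2) (j + k) + monom (a * cnj b / 2) (j - k)) z
      = ((a * z ^ j) * (b * z ^ k) + (a * z ^ j) * cnj (b * z ^ k)) / 2"
    by (simp add: poly_monom power_add field_simps)
  also have "Re \<dots> = Re (a * z ^ j) * Re (b * z ^ k)"
  proof -
    have "Re ((x * y + x * cnj y) / 2) = Re x * Re y" for x y by simp
    then show ?thesis .
  qed
  finally show "Re (a * z ^ j) * Re (b * z ^ k)
      = Re (poly (monom (a * b / 2) (j + k) + monom (a * cnj b / 2) (j - k)) z)" by simp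
qed

lemma Re_polynomial_on_circle_mult:
  assumes "Re_polynomial_on_circle p" "Re_polynomial_on_circle q"
  shows "Re_polynomial_on_circle (\<lambda>z. p z * q z)"
proof -
  obtain P Q where PQ: "\<And>z. cmod z = 1 \<Longrightarrow> p z = Re (poly P z)" "\<And>z. cmod z = 1 \<Longrightarrow> q z = Re (poly Q z)"
    using assms unfolding Re_polynomial_on_circle_def by blast
  have mono: "Re_polynomial_on_circle (\<lambda>z. Re (a * z ^ j) * Re (b * z ^ k))" for a b j k
    using Re_monomials_mult[of k j a b] Re_monomials_mult[of j k b a]
    by (cases "k \<le> j") (auto simp: mult.commute)
  have "Re_polynomial_on_circle (\<lambda>z. \<Sum>j\<le>degree P. \<Sum>k\<le>degree Q. Re (coeff P j * z ^ j) * Re (coeff Q k * z ^ k))"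
    by (intro Re_polynomial_on_circle_sum mono) auto
  then obtain R where R: "\<And>z. cmod z = 1 \<Longrightarrow> (\<Sum>j\<le>degree P. \<Sum>k\<le>degree Q.
       Re (coeff P j * z ^ j) * Re (coeff Q k * z ^ k)) = Re (poly R z)"
    unfolding Re_polynomial_on_circle_def by blast
  have "p z * q z = Re (poly R z)" if "cmod z = 1" for z
    unfolding R[OF that, symmetric] PQ(1)[OF that] PQ(2)[OF that] poly_altdef[of P] poly_altdef[of Q]
    by (simp only: Re_sum sum_product)
  then show ?thesis unfolding Re_polynomial_on_circle_def by blast
qed

lemma Re_polynomial_on_circle_real_polynomial:
  fixes p :: "complex \<Rightarrow> real"
  assumes "real_polynomial_function p"
  shows "Re_polynomial_on_circle p"
  using assms
proof (induction rule: real_polynomial_function.induct)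
  case (linear f)
  interpret bounded_linear f by fact
  have "f z = Re (poly [:0, Complex (f 1) (- f \<i>):] z)" for z
  proof -
    have "f z = f (Re z *\<^sub>R 1 + Im z *\<^sub>R \<i>)"
      by (rule arg_cong[of _ _ f]) (simp add: complex_eq_iff)
    also have "\<dots> = Re z * f 1 + Im z * f \<i>" unfolding add scaleR by simp
    finally show ?thesis by simp
  qed
  then show ?case unfolding Re_polynomial_on_circle_def by blast
next
  case (const c)
  show ?case unfolding Re_polynomial_on_circle_def by (intro exI[of _ "[:of_real c:]"]) auto
qed (auto intro: Re_polynomial_on_circle_add Re_polynomial_on_circle_mult)

text \<open>
  Entire functions have the mean value property, so a function whose value at the centre is
  at most that of every harmonic majorant on the rim satisfies the sub-mean-value inequality, provided
  the majorants come arbitrarily close on the rim. They do, by Stone-Weierstrass.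
\<close>

lemma submean_if_below_harmonic:
  fixes v :: "complex \<Rightarrow> real"
  assumes r: "r > 0" and contv: "continuous_on (cball z0 r) v"
    and below: "\<And>F. F holomorphic_on UNIV \<Longrightarrow> (\<And>\<zeta>. \<zeta> \<in> sphere z0 r \<Longrightarrow> v \<zeta> < Re (F \<zeta>))
                     \<Longrightarrow> v z0 \<le> Re (F z0)"
  shows "v z0 \<le> integral {0..2*pi} (\<lambda>t. v (z0 + of_real r * cis t)) / (2 * pi)"
proof (rule field_le_epsilon)
  fix e :: real assume e: "e > 0"
  \<comment> \<open>Approximating \<open>v + e / 2\<close> up to \<open>e / 2\<close> yields a strict majorant of \<open>v\<close>.\<close>
  define w where "w = (\<lambda>z. v (z0 + of_real r * z) + e / 2)"
  have "continuous_on (sphere 0 1) w"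
    unfolding w_def using r
    by (intro continuous_intros continuous_on_compose2[OF contv]) (auto simp: dist_norm norm_mult)
  then obtain p where p: "real_polynomial_function p" "\<And>z. z \<in> sphere 0 1 \<Longrightarrow> \<bar>w z - p z\<bar> < e / 2"
    using Stone_Weierstrass_real_polynomial_function[of "sphere 0 1" w "e / 2"] e by auto
  obtain P where P: "\<And>z. cmod z = 1 \<Longrightarrow> p z = Re (poly P z)"
    using Re_polynomial_on_circle_real_polynomial[OF p(1)] unfolding Re_polynomial_on_circle_def by blast
  define F where "F = (\<lambda>\<zeta>. poly P ((\<zeta> - z0) / of_real r))"
  have holF: "F holomorphic_on UNIV"
    unfolding F_def using r by (intro holomorphic_intros) auto
  have near: "v (z0 + of_real r * z) < Re (F (z0 + of_real r * z))
     \<and> Re (F (z0 + of_real r * z)) \<le> v (z0 + of_real r * z) + e" if "cmod z = 1" for z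
  proof -
    have "\<bar>v (z0 + of_real r * z) + e / 2 - Re (F (z0 + of_real r * z))\<bar> < e / 2"
      using p(2)[of z] that P[OF that] r by (simp add: F_def w_def)
    then show ?thesis unfolding abs_less_iff by (simp add: field_simps)
  qed
  have "v z0 \<le> Re (F z0)"
  proof (rule below[OF holF])
    fix \<zeta> assume "\<zeta> \<in> sphere z0 r"
    then have "cmod ((\<zeta> - z0) / of_real r) = 1"
      using r by (simp add: norm_divide dist_norm norm_minus_commute)
    from near[OF this] show "v \<zeta> < Re (F \<zeta>)" using r by simp
  qed
  have mean: "((\<lambda>t. Re (F (z0 + of_real r * cis t))) has_integral Re (2 * of_real pi * F z0)) {0..2*pi}"
    by (rule has_integral_Re[OF mean_value_entire[OF holF r]])
  have contc: "continuous_on {0..2*pi} (\<lambda>t. v (z0 + of_real r * cis t))"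
    using r by (intro continuous_intros continuous_on_compose2[OF contv]) (auto simp: dist_norm norm_mult)
  have "((\<lambda>t. v (z0 + of_real r * cis t) + e) has_integral
          (integral {0..2*pi} (\<lambda>t. v (z0 + of_real r * cis t)) + 2 * pi * e)) {0..2*pi}"
    using has_integral_add[OF integrable_integral[OF integrable_continuous_interval[OF contc]]
        has_integral_const_real[of e 0 "2*pi"]] by simp
  from has_integral_le[OF mean this] near
  have "2 * pi * Re (F z0) \<le> integral {0..2*pi} (\<lambda>t. v (z0 + of_real r * cis t)) + 2 * pi * e"
    by simp
  then have "Re (F z0) \<le> integral {0..2*pi} (\<lambda>t. v (z0 + of_real r * cis t)) / (2 * pi) + e"
    by (simp add: field_simps)
  with \<open>v z0 \<le> Re (F z0)\<close>
  show "v z0 \<le> integral {0..2*pi} (\<lambda>t. v (z0 + of_real r * cis t)) / (2 * pi) + e" by simp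
qed

section \<open>The boundary distance\<close>

lemma norm_complex_scale:
  fixes x :: "complex ^ 'n"
  shows "norm (c *s x) = cmod c * norm x"
  by (simp add: norm_vec_def norm_mult L2_set_right_distrib)

lemma continuous_on_complex_line:
  fixes a w :: "complex ^ 'n"
  assumes "continuous_on S f" "continuous_on S h"
  shows "continuous_on S (\<lambda>x. h x + f x *s w)"
proof -
  have "continuous_on S (\<lambda>x. \<chi> i. h x $ i + f x * w $ i)"
    by (intro continuous_intros assms)
  moreover have "(\<lambda>x. \<chi> i. h x $ i + f x * w $ i) = (\<lambda>x. h x + f x *s w)"
    by (auto simp: fun_eq_iff vec_eq_iff)
  ultimately show ?thesis by (simp only:)
qed

text \<open>
  If some \<open>y\<close> outside \<open>D\<close> were closer to the centre than \<open>exp (- Re (F z0))\<close>, the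
  discs \<open>\<Psi> t\<close> below would join the given disc to one through \<open>y\<close> without their rims leaving \<open>D\<close>,
  against the continuity principle.
\<close>

lemma neg_log_boundary_distance_submean:
  fixes D :: "(complex ^ 'n) set"
  assumes D: "open D" "locally_weakly_linearly_convex D" "D \<noteq> UNIV"
    and r: "r > 0" and sub: "\<And>\<zeta>. \<zeta> \<in> cball z0 r \<Longrightarrow> a + \<zeta> *s w \<in> D"
  shows "- ln (infdist (a + z0 *s w) (- D))
     \<le> integral {0..2*pi} (\<lambda>t. - ln (infdist (a + (z0 + of_real r * cis t) *s w) (- D))) / (2 * pi)"
proof (rule submean_if_below_harmonic[OF r, where v = "\<lambda>\<zeta>. - ln (infdist (a + \<zeta> *s w) (- D))"])
  have pos: "infdist (a + \<zeta> *s w) (- D) > 0" if "\<zeta> \<in> cball z0 r" for \<zeta>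
    using D sub[OF that] by (intro infdist_pos_not_in_closed) auto
  show "continuous_on (cball z0 r) (\<lambda>\<zeta>. - ln (infdist (a + \<zeta> *s w) (- D)))"
    using pos by (intro continuous_intros continuous_on_complex_line) force
next
  fix F assume F: "F holomorphic_on UNIV"
    and below: "\<And>\<zeta>. \<zeta> \<in> sphere z0 r \<Longrightarrow> - ln (infdist (a + \<zeta> *s w) (- D)) < Re (F \<zeta>)"
  have rim_dist: "exp (- Re (F \<zeta>)) < infdist (a + \<zeta> *s w) (- D)" if "\<zeta> \<in> sphere z0 r" for \<zeta>
  proof -
    have "infdist (a + \<zeta> *s w) (- D) > 0"
      using D sub[of \<zeta>] that by (intro infdist_pos_not_in_closed) auto
    moreover have "- Re (F \<zeta>) < ln (infdist (a + \<zeta> *s w) (- D))"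
      using below[OF that] by simp
    ultimately show ?thesis by (metis exp_less_cancel_iff exp_ln)
  qed
  have outside_far: "exp (- Re (F z0)) \<le> dist (a + z0 *s w) y" if y: "y \<in> - D" for y
  proof (rule ccontr)
    assume "\<not> exp (- Re (F z0)) \<le> dist (a + z0 *s w) y"
    then have less: "norm (y - (a + z0 *s w)) < exp (- Re (F z0))"
      by (simp add: dist_norm norm_minus_commute)
    \<comment> \<open>\<open>V\<close> is chosen so that the disc for \<open>t = 1\<close> passes through \<open>y\<close> at \<open>z0\<close>.\<close>
    define V where "V = exp (F z0) *s (y - (a + z0 *s w))"
    define \<Psi> where "\<Psi> = (\<lambda>(t::real) \<zeta>. (a + \<zeta> *s w) + (of_real t * exp (- F \<zeta>)) *s V)"
    have V1: "norm V < 1"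
    proof -
      have "norm V = exp (Re (F z0)) * norm (y - (a + z0 *s w))"
        by (simp only: V_def norm_complex_scale norm_exp_eq_Re)
      also have "\<dots> < exp (Re (F z0)) * exp (- Re (F z0))" using less by simp
      finally show ?thesis by (simp add: exp_minus)
    qed
    have contF: "continuous_on A (\<lambda>x. F (h x))" if "continuous_on A h" for A :: "(real \<times> complex) set" and h
      using continuous_on_compose2[OF holomorphic_on_imp_continuous_on[OF F] that] by simp
    have "\<Psi> 1 ` cball z0 r \<subseteq> D"
    proof (rule continuity_principle[OF D(1,2) r])
      show "continuous_on ({0..1} \<times> cball z0 r) (\<lambda>(t, \<zeta>). \<Psi> t \<zeta>)"
        unfolding \<Psi>_def case_prod_unfold
        by (intro continuous_on_complex_line continuous_intros contF)
      show "(\<lambda>\<zeta>. \<Psi> t \<zeta> $ i) holomorphic_on ball z0 r" for t i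
        unfolding \<Psi>_def using F
        by (auto intro!: holomorphic_intros intro: holomorphic_on_subset)
      show "\<Psi> 0 ` cball z0 r \<subseteq> D"
        using sub by (auto simp: \<Psi>_def)
      show "\<Psi> t ` sphere z0 r \<subseteq> D" if t: "t \<in> {0..1}" for t
      proof
        fix x assume "x \<in> \<Psi> t ` sphere z0 r"
        then obtain \<zeta> where \<zeta>: "\<zeta> \<in> sphere z0 r" "x = \<Psi> t \<zeta>" by blast
        have "dist (a + \<zeta> *s w) x = t * exp (- Re (F \<zeta>)) * norm V"
          using t by (simp add: \<zeta> \<Psi>_def dist_norm norm_complex_scale norm_mult)
        also have "\<dots> \<le> 1 * exp (- Re (F \<zeta>)) * 1"
          using t V1 by (intro mult_mono) auto
        finally have "dist (a + \<zeta> *s w) x < infdist (a + \<zeta> *s w) (- D)"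
          using rim_dist[OF \<zeta>(1)] by simp
        then show "x \<in> D"
          using infdist_le[of x "- D" "a + \<zeta> *s w"] by fastforce
      qed
    qed auto
    moreover have "\<Psi> 1 z0 = y"
      by (simp add: \<Psi>_def V_def vector_smult_assoc exp_minus)
    ultimately show False using y r by force
  qed
  have "exp (- Re (F z0)) \<le> infdist (a + z0 *s w) (- D)"
  proof -
    have ne: "- D \<noteq> {}" using D(3) by blast
    show ?thesis
      unfolding infdist_notempty[OF ne] using outside_far ne by (intro cINF_greatest)
  qed
  then show "- ln (infdist (a + z0 *s w) (- D)) \<le> Re (F z0)"
    using ln_ge_iff[of "infdist (a + z0 *s w) (- D)" "- Re (F z0)"]
      less_le_trans[OF exp_gt_zero] by fastforce
qed

section \<open>The plurisubharmonic exhaustion function\<close>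

text \<open>The mean of an affine disc over its rim is its centre, and a norm is convex.\<close>

lemma norm_submean:
  fixes a w :: "complex ^ 'n"
  assumes r: "r > 0"
  shows "norm (a + z0 *s w) \<le> integral {0..2*pi} (\<lambda>t. norm (a + (z0 + of_real r * cis t) *s w)) / (2 * pi)"
proof -
  have lin: "bounded_linear (\<lambda>x::complex. x *s w)"
    by (intro linear_conv_bounded_linear[THEN iffD1] linearI)
       (simp_all add: vec_eq_iff algebra_simps)
  have "((\<lambda>t. z0 + of_real r * cis t) has_integral 2 * of_real pi * z0) {0..2*pi}"
    using mean_value_entire[of "\<lambda>z. z" r z0] r by simp
  from has_integral_linear[OF this lin]
  have "((\<lambda>t. (z0 + of_real r * cis t) *s w) has_integral (2 * of_real pi * z0) *s w) {0..2*pi}"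
    by (simp add: o_def)
  from has_integral_add[OF has_integral_const_real[of a 0 "2*pi"] this]
  have "((\<lambda>t. a + (z0 + of_real r * cis t) *s w) has_integral
          (2 * pi) *\<^sub>R a + (2 * of_real pi * z0) *s w) {0..2*pi}" by simp
  moreover have "(2 * pi) *\<^sub>R a + (2 * of_real pi * z0) *s w = (2 * pi) *\<^sub>R (a + z0 *s w)"
    by (simp add: vec_eq_iff scaleR_conv_of_real[where 'a = complex] distrib_left mult.assoc)
  ultimately have hi: "((\<lambda>t. a + (z0 + of_real r * cis t) *s w) has_integral
          (2 * pi) *\<^sub>R (a + z0 *s w)) {0..2*pi}" by simp
  have "(\<lambda>t. norm (a + (z0 + of_real r * cis t) *s w)) integrable_on {0..2*pi}"
    by (intro integrable_continuous_interval continuous_on_complex_line continuous_intros)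
  from integral_norm_bound_integral[OF _ this, of "\<lambda>t. a + (z0 + of_real r * cis t) *s w"] hi
  have "norm ((2 * pi) *\<^sub>R (a + z0 *s w)) \<le> integral {0..2*pi} (\<lambda>t. norm (a + (z0 + of_real r * cis t) *s w))"
    by (auto simp: has_integral_iff)
  then show ?thesis by (simp add: pos_le_divide_eq mult.commute)
qed

lemma integrable_on_circle:
  fixes u :: "complex \<Rightarrow> real"
  assumes "continuous_on G u" "cball \<zeta> r \<subseteq> G" "r > 0"
  shows "(\<lambda>t. u (\<zeta> + of_real r * cis t)) integrable_on {0..2*pi}"
proof (intro integrable_continuous_interval continuous_on_compose2[OF assms(1)] continuous_intros)
  have "\<zeta> + of_real r * cis t \<in> cball \<zeta> r" for t
    using assms(3) by (simp add: dist_norm norm_mult)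
  with assms(2) show "(\<lambda>t. \<zeta> + of_real r * cis t) ` {0..2*pi} \<subseteq> G" by auto
qed

lemma continuous_subharmonic_max:
  assumes "continuous_subharmonic_on G u" "continuous_subharmonic_on G v"
  shows "continuous_subharmonic_on G (\<lambda>z. max (u z) (v z))"
proof -
  let ?m = "\<lambda>z. max (u z) (v z)"
  have u: "continuous_on G u" and v: "continuous_on G v"
    using assms by (auto simp: continuous_subharmonic_on_def)
  then have m: "continuous_on G ?m" by (intro continuous_intros)
  have "?m \<zeta> \<le> integral {0..2 * pi} (\<lambda>t. ?m (\<zeta> + of_real r * cis t)) / (2 * pi)"
    if r: "0 < r" "cball \<zeta> r \<subseteq> G" for \<zeta> r
  proof -
    note I = integrable_on_circle[OF _ r(2,1)]
    have "u \<zeta> \<le> integral {0..2 * pi} (\<lambda>t. u (\<zeta> + of_real r * cis t)) / (2 * pi)"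
      using assms(1) r unfolding continuous_subharmonic_on_def by blast
    also have "\<dots> \<le> integral {0..2 * pi} (\<lambda>t. ?m (\<zeta> + of_real r * cis t)) / (2 * pi)"
      using I[OF u] I[OF m] by (intro divide_right_mono integral_le) auto
    finally have 1: "u \<zeta> \<le> \<dots>" .
    have "v \<zeta> \<le> integral {0..2 * pi} (\<lambda>t. v (\<zeta> + of_real r * cis t)) / (2 * pi)"
      using assms(2) r unfolding continuous_subharmonic_on_def by blast
    also have "\<dots> \<le> integral {0..2 * pi} (\<lambda>t. ?m (\<zeta> + of_real r * cis t)) / (2 * pi)"
      using I[OF v] I[OF m] by (intro divide_right_mono integral_le) auto
    finally show ?thesis using 1 by simp
  qed
  with m show ?thesis unfolding continuous_subharmonic_on_def by blast
qed

lemma continuous_psh_max: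
  assumes "continuous_plurisubharmonic_on D u" "continuous_plurisubharmonic_on D v"
  shows "continuous_plurisubharmonic_on D (\<lambda>z. max (u z) (v z))"
  using assms unfolding continuous_plurisubharmonic_on_def
  by (auto intro: continuous_on_max continuous_subharmonic_max)

lemma continuous_pshI:
  fixes D :: "(complex ^ 'n) set"
  assumes cont: "continuous_on D u"
    and submean: "\<And>a w z0 r. r > 0 \<Longrightarrow> (\<And>\<zeta>. \<zeta> \<in> cball z0 r \<Longrightarrow> a + \<zeta> *s w \<in> D) \<Longrightarrow>
      u (a + z0 *s w) \<le> integral {0..2*pi} (\<lambda>t. u (a + (z0 + of_real r * cis t) *s w)) / (2 * pi)"
  shows "continuous_plurisubharmonic_on D u"
  unfolding continuous_plurisubharmonic_on_def continuous_subharmonic_on_def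
proof (intro conjI allI impI)
  show "continuous_on {\<zeta>. a + \<zeta> *s w \<in> D} (\<lambda>\<zeta>. u (a + \<zeta> *s w))" for a w
    by (intro continuous_on_compose2[OF cont] continuous_on_complex_line continuous_intros) auto
  show "continuous_on D u" by fact
next
  fix a w \<zeta> r assume "0 < r \<and> cball \<zeta> r \<subseteq> {\<zeta>. a + \<zeta> *s w \<in> D}"
  then show "u (a + \<zeta> *s w)
      \<le> integral {0..2 * pi} (\<lambda>t. u (a + (\<zeta> + of_real r * cis t) *s w)) / (2 * pi)"
    by (intro submean) auto
qed

lemma continuous_psh_norm: "continuous_plurisubharmonic_on D (norm :: complex ^ 'n \<Rightarrow> real)"
  by (intro continuous_pshI norm_submean continuous_intros)

lemma continuous_psh_neg_log_boundary_distance: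
  fixes D :: "(complex ^ 'n) set"
  assumes D: "open D" "locally_weakly_linearly_convex D" "D \<noteq> UNIV"
  shows "continuous_plurisubharmonic_on D (\<lambda>z. - ln (infdist z (- D)))"
proof (rule continuous_pshI)
  have "infdist z (- D) > 0" if "z \<in> D" for z
    using D that by (intro infdist_pos_not_in_closed) auto
  then show "continuous_on D (\<lambda>z. - ln (infdist z (- D)))"
    by (intro continuous_intros) force
qed (rule neg_log_boundary_distance_submean[OF D])

text \<open>
  The norm bounds the sublevel sets and the logarithm keeps them away from the boundary. The
  whole space is treated apart, since \<open>infdist\<close> to the empty complement has the default
  value 0.
\<close>

lemma pseudoconvex_if_lwlc:
  fixes D :: "(complex ^ 'n) set"
  assumes D: "open D" "locally_weakly_linearly_convex D"
  shows "pseudoconvex D"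
proof (cases "D = UNIV")
  case True
  have "closure {z :: complex ^ 'n. norm z < c} \<subseteq> cball 0 c" for c
    by (intro closure_minimal) auto
  then have "compact (closure {z :: complex ^ 'n. norm z < c})" for c
    by (meson bounded_cball bounded_closure bounded_subset closure_subset compact_closure order_trans)
  then show ?thesis
    unfolding pseudoconvex_def using continuous_psh_norm[of D] True by auto
next
  case False
  let ?u = "\<lambda>z. max (- ln (infdist z (- D))) (norm z)"
  have pos: "infdist z (- D) > 0" if "z \<in> D" for z
    using D False that by (intro infdist_pos_not_in_closed) auto
  have "compact (closure {z \<in> D. ?u z < c}) \<and> closure {z \<in> D. ?u z < c} \<subseteq> D" for c
  proof
    have "bounded {z \<in> D. ?u z < c}"
      by (rule bounded_subset[OF bounded_cball[of 0 c]]) auto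
    then show "compact (closure {z \<in> D. ?u z < c})" by (simp add: compact_closure)
    have "closed {z. exp (- c) \<le> infdist z (- D)}"
      by (intro closed_Collect_le continuous_intros)
    moreover have "{z \<in> D. ?u z < c} \<subseteq> {z. exp (- c) \<le> infdist z (- D)}"
    proof
      fix z assume z: "z \<in> {z \<in> D. ?u z < c}"
      then have "- c \<le> ln (infdist z (- D))" by simp
      with pos[of z] z show "z \<in> {z. exp (- c) \<le> infdist z (- D)}" by (simp add: ln_ge_iff)
    qed
    ultimately have "closure {z \<in> D. ?u z < c} \<subseteq> {z. exp (- c) \<le> infdist z (- D)}"
      by (rule closure_minimal[rotated])
    also have "\<dots> \<subseteq> D"
    proof
      fix z assume "z \<in> {z. exp (- c) \<le> infdist z (- D)}"
      then have "infdist z (- D) > 0" by (auto intro: less_le_trans[OF exp_gt_zero])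
      then show "z \<in> D" by (metis ComplI infdist_zero less_irrefl)
    qed
    finally show "closure {z \<in> D. ?u z < c} \<subseteq> D" .
  qed
  moreover have "continuous_plurisubharmonic_on D ?u"
    by (intro continuous_psh_max continuous_psh_norm
        continuous_psh_neg_log_boundary_distance D False)
  ultimately show ?thesis unfolding pseudoconvex_def by blast
qed

section \<open>Tautness\<close>

text \<open>
  Induction over the finitely many components, passing to a further subsequence for each of them.
\<close>

lemma vector_Montel:
  fixes \<phi> :: "nat \<Rightarrow> complex \<Rightarrow> complex ^ 'n"
  assumes S: "open S"
    and hol: "\<And>n i. (\<lambda>\<zeta>. \<phi> n \<zeta> $ i) holomorphic_on S"
    and bdd: "\<And>n \<zeta>. \<zeta> \<in> S \<Longrightarrow> norm (\<phi> n \<zeta>) \<le> B"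
  obtains g :: "complex \<Rightarrow> complex ^ 'n" and s where "strict_mono (s :: nat \<Rightarrow> nat)" "\<And>i. (\<lambda>\<zeta>. g \<zeta> $ i) holomorphic_on S"
    "\<And>K. compact K \<Longrightarrow> K \<subseteq> S \<Longrightarrow> uniform_limit K (\<phi> \<circ> s) g sequentially"
proof -
  have "\<exists>s h. strict_mono (s :: nat \<Rightarrow> nat) \<and> (\<forall>i\<in>I. h i holomorphic_on S \<and>
     (\<forall>K. compact K \<and> K \<subseteq> S \<longrightarrow> uniform_limit K (\<lambda>n \<zeta>. \<phi> (s n) \<zeta> $ i) (h i) sequentially))"
    if "finite I" for I
    using that
  proof (induction I rule: finite_induct)
    case empty
    show ?case by (intro exI[of _ id]) (auto simp: strict_mono_def)
  next
    case (insert i I)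
    then obtain s h where sh: "strict_mono (s :: nat \<Rightarrow> nat)"
      "\<And>j. j \<in> I \<Longrightarrow> h j holomorphic_on S"
      "\<And>j K. j \<in> I \<Longrightarrow> compact K \<Longrightarrow> K \<subseteq> S
         \<Longrightarrow> uniform_limit K (\<lambda>n \<zeta>. \<phi> (s n) \<zeta> $ j) (h j) sequentially"
      by metis
    obtain k q where kq: "k holomorphic_on S" "strict_mono (q :: nat \<Rightarrow> nat)"
      "\<And>K. compact K \<Longrightarrow> K \<subseteq> S
         \<Longrightarrow> uniform_limit K ((\<lambda>n \<zeta>. \<phi> (s n) \<zeta> $ i) \<circ> q) k sequentially"
    proof (rule Montel[OF S, of "range (\<lambda>n \<zeta>. \<phi> (s n) \<zeta> $ i)" "\<lambda>n \<zeta>. \<phi> (s n) \<zeta> $ i"])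
      show "h holomorphic_on S" if "h \<in> range (\<lambda>n \<zeta>. \<phi> (s n) \<zeta> $ i)" for h
        using that hol by auto
      show "\<exists>B. \<forall>h\<in>range (\<lambda>n \<zeta>. \<phi> (s n) \<zeta> $ i). \<forall>z\<in>K. cmod (h z) \<le> B" if "K \<subseteq> S" for K
        using that bdd Finite_Cartesian_Product.norm_nth_le order_trans by (intro exI[of _ B]) blast
    qed auto
    show ?case
    proof (intro exI conjI ballI)
      show "strict_mono (s \<circ> q)" using sh(1) kq(2) by (rule strict_mono_o)
      fix j assume j: "j \<in> insert i I"
      show "(h(i := k)) j holomorphic_on S" using j sh(2) kq(1) by auto
      show "\<forall>K. compact K \<and> K \<subseteq> S \<longrightarrow>
          uniform_limit K (\<lambda>n \<zeta>. \<phi> ((s \<circ> q) n) \<zeta> $ j) ((h(i := k)) j) sequentially"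
      proof (intro allI impI)
        fix K assume K: "compact K \<and> K \<subseteq> S"
        show "uniform_limit K (\<lambda>n \<zeta>. \<phi> ((s \<circ> q) n) \<zeta> $ j) ((h(i := k)) j) sequentially"
        proof (cases "j = i")
          case True
          then show ?thesis using kq(3)[of K] K by (simp add: o_def)
        next
          case False
          then show ?thesis
            using filterlim_compose[OF sh(3)[of j K] filterlim_subseq[OF kq(2)]] K j by auto
        qed
      qed
    qed
  qed
  from this[OF finite[of UNIV]] obtain s h where sh: "strict_mono (s :: nat \<Rightarrow> nat)"
      "\<And>j. h j holomorphic_on S"
      "\<And>j K. compact K \<Longrightarrow> K \<subseteq> S
         \<Longrightarrow> uniform_limit K (\<lambda>n \<zeta>. \<phi> (s n) \<zeta> $ j) (h j) sequentially"
    by blast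
  show ?thesis
  proof (rule that[of s "\<lambda>\<zeta>. \<chi> i. h i \<zeta>"])
    show "strict_mono s" by fact
    show "(\<lambda>\<zeta>. (\<chi> i. h i \<zeta>) $ i) holomorphic_on S" for i using sh(2) by simp
    fix K assume K: "compact K" "K \<subseteq> S"
    show "uniform_limit K (\<phi> \<circ> s) (\<lambda>\<zeta>. \<chi> i. h i \<zeta>) sequentially"
    proof (rule uniform_limitI)
      fix e :: real assume e: "e > 0"
      let ?d = "e / real CARD('n)"
      have "\<forall>\<^sub>F n in sequentially. \<forall>\<zeta>\<in>K. dist (\<phi> (s n) \<zeta> $ i) (h i \<zeta>) < ?d" for i
        using sh(3)[OF K, of i] e by (intro uniform_limitD) auto
      then have "\<forall>\<^sub>F n in sequentially. \<forall>i. \<forall>\<zeta>\<in>K. dist (\<phi> (s n) \<zeta> $ i) (h i \<zeta>) < ?d"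
        by (rule eventually_all_finite)
      then show "\<forall>\<^sub>F n in sequentially. \<forall>\<zeta>\<in>K. dist ((\<phi> \<circ> s) n \<zeta>) (\<chi> i. h i \<zeta>) < e"
      proof (eventually_elim, intro ballI)
        fix n \<zeta> assume *: "\<forall>i. \<forall>\<zeta>\<in>K. dist (\<phi> (s n) \<zeta> $ i) (h i \<zeta>) < ?d" and "\<zeta> \<in> K"
        have "dist ((\<phi> \<circ> s) n \<zeta>) (\<chi> i. h i \<zeta>) \<le> (\<Sum>i\<in>UNIV. dist (\<phi> (s n) \<zeta> $ i) (h i \<zeta>))"
          by (simp add: dist_vec_def L2_set_le_sum)
        also have "\<dots> < (\<Sum>i\<in>(UNIV :: 'n set). ?d)"
          using * \<open>\<zeta> \<in> K\<close> by (intro sum_strict_mono) auto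
        finally show "dist ((\<phi> \<circ> s) n \<zeta>) (\<chi> i. h i \<zeta>) < e" by simp
      qed
    qed
  qed
qed

lemma taut_if_bounded_lwlc:
  fixes D :: "(complex ^ 'n) set"
  assumes D: "open D" "locally_weakly_linearly_convex D" "bounded D"
  shows "taut D"
  unfolding taut_def
proof (intro allI impI)
  fix \<phi> :: "nat \<Rightarrow> complex \<Rightarrow> complex ^ 'n"
  assume "\<forall>j. \<phi> j \<in> holomorphic_discs D"
  then have hol: "\<And>j i. (\<lambda>\<zeta>. \<phi> j \<zeta> $ i) holomorphic_on ball 0 1"
    and inD: "\<And>j \<zeta>. \<zeta> \<in> ball 0 1 \<Longrightarrow> \<phi> j \<zeta> \<in> D"
    unfolding holomorphic_discs_def by blast+
  obtain B where "\<And>x. x \<in> D \<Longrightarrow> norm x \<le> B"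
    using D(3) unfolding bounded_iff by blast
  with inD have bdd: "norm (\<phi> j \<zeta>) \<le> B" if "\<zeta> \<in> ball 0 1" for j \<zeta>
    using that by blast
  obtain g :: "complex \<Rightarrow> complex ^ 'n" and s where s: "strict_mono (s :: nat \<Rightarrow> nat)"
    and holg: "\<And>i. (\<lambda>\<zeta>. g \<zeta> $ i) holomorphic_on ball 0 1"
    and lim: "\<And>K. compact K \<Longrightarrow> K \<subseteq> ball 0 1 \<Longrightarrow> uniform_limit K (\<phi> \<circ> s) g sequentially"
  proof (rule vector_Montel[of "ball 0 1" \<phi> B, OF open_ball hol])
    show "norm (\<phi> j \<zeta>) \<le> B" if "\<zeta> \<in> ball 0 1" for j \<zeta> by (rule bdd[OF that])
  next
    fix g :: "complex \<Rightarrow> complex ^ 'n" and s :: "nat \<Rightarrow> nat"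
    assume 1: "strict_mono s" and 2: "\<And>i. (\<lambda>\<zeta>. g \<zeta> $ i) holomorphic_on ball 0 1"
      and 3: "\<And>K. compact K \<Longrightarrow> K \<subseteq> ball 0 1 \<Longrightarrow> uniform_limit K (\<phi> \<circ> s) g sequentially"
    show thesis by (rule that[OF 1 2 3])
  qed
  have "g ` ball 0 1 \<subseteq> D \<or> g ` ball 0 1 \<inter> D = {}"
  proof (rule limit_of_discs_inside_or_outside[OF D(1,2), where f = "\<phi> \<circ> s"])
    show "(\<lambda>\<zeta>. (\<phi> \<circ> s) n \<zeta> $ i) holomorphic_on ball 0 1" for n i
      using hol by simp
    show "(\<phi> \<circ> s) n \<zeta> \<in> D" if "\<zeta> \<in> ball 0 1" for n \<zeta>
      using inD that by simp
  qed (use holg lim in auto)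
  then have "(\<exists>g\<in>holomorphic_discs D. locally_uniform_limit_on_disc (\<phi> \<circ> s) g) \<or>
            compactly_divergent D (\<phi> \<circ> s)"
  proof
    assume "g ` ball 0 1 \<subseteq> D"
    then have "g \<in> holomorphic_discs D" using holg by (simp add: holomorphic_discs_def)
    moreover have "locally_uniform_limit_on_disc (\<phi> \<circ> s) g"
      unfolding locally_uniform_limit_on_disc_def
    proof
      fix \<zeta> :: complex assume "\<zeta> \<in> ball 0 1"
      then obtain r where r: "r > 0" "cball \<zeta> r \<subseteq> ball 0 1"
        using open_contains_cball open_ball by blast
      then have "uniform_limit (ball \<zeta> r) (\<phi> \<circ> s) g sequentially"
        by (intro uniform_limit_on_subset[OF lim[OF compact_cball r(2)] ball_subset_cball])
      with r show "\<exists>V. open V \<and> \<zeta> \<in> V \<and> V \<subseteq> ball 0 1 \<and> uniform_limit V (\<phi> \<circ> s) g sequentially"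
        using ball_subset_cball[of \<zeta> r] centre_in_ball open_ball by blast
    qed
    ultimately show ?thesis by blast
  next
    assume out: "g ` ball 0 1 \<inter> D = {}"
    have "compactly_divergent D (\<phi> \<circ> s)"
      unfolding compactly_divergent_def
    proof (intro allI impI)
      fix K :: "complex set" and L :: "(complex ^ 'n) set"
      assume KL: "compact K \<and> K \<subseteq> ball 0 1 \<and> compact L \<and> L \<subseteq> D"
      have "compact (g ` K)"
        using KL continuous_on_subset[OF continuous_on_holomorphic_components[OF holg]]
        by (intro compact_continuous_image) auto
      moreover have "g ` K \<inter> L = {}" using KL out by blast
      ultimately obtain d where d: "d > 0" "\<And>x y. x \<in> g ` K \<Longrightarrow> y \<in> L \<Longrightarrow> d \<le> dist x y"
        using KL separate_compact_closed[of "g ` K" L] compact_imp_closed[of L] by blast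
      have "\<forall>\<^sub>F n in sequentially. \<forall>x\<in>K. dist ((\<phi> \<circ> s) n x) (g x) < d"
        using KL by (intro uniform_limitD[OF lim d(1)]) auto
      then show "\<forall>\<^sub>F j in sequentially. (\<phi> \<circ> s) j ` K \<inter> L = {}"
      proof eventually_elim
        fix n assume near: "\<forall>x\<in>K. dist ((\<phi> \<circ> s) n x) (g x) < d"
        have "(\<phi> \<circ> s) n x \<notin> L" if "x \<in> K" for x
        proof
          assume "(\<phi> \<circ> s) n x \<in> L"
          then have "d \<le> dist (g x) ((\<phi> \<circ> s) n x)" using that by (intro d(2)) auto
          moreover have "dist ((\<phi> \<circ> s) n x) (g x) < d" using near that by blast
          ultimately show False by (simp add: dist_commute)
        qed
        then show "(\<phi> \<circ> s) n ` K \<inter> L = {}" by blast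
      qed
    qed
    then show ?thesis by blast
  qed
  with s show "\<exists>s :: nat \<Rightarrow> nat. strict_mono s \<and>
           ((\<exists>g\<in>holomorphic_discs D. locally_uniform_limit_on_disc (\<phi> \<circ> s) g) \<or>
            compactly_divergent D (\<phi> \<circ> s))"
    by blast
qed

section \<open>Pseudoconvexity and tautness\<close>

theorem mainTheorem5:
  fixes D :: "(complex ^ 'n) set"
  assumes "complex_domain D"
    and "locally_weakly_linearly_convex D"
  shows "pseudoconvex D \<and> (bounded D \<longrightarrow> taut D)"
  using assms pseudoconvex_if_lwlc taut_if_bounded_lwlc
  by (auto simp: complex_domain_def)

end
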